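(* For every $\epsilon>0$, the asymptotic formula $$ \sum_{\substack{n\leq X\\ n\equiv a \pmod q}}\mu^2(n)\sim\frac{1}{\varphi(q)}\sum_{\substack{n\leq X\\ (n,q)=1}}\mu^2(n) $$ holds as $X\rightarrow\infty$, uniformly for primes $q\leq X^{\frac23}(\log X)^{\frac16-\epsilon}$ and integers $a$ with $(a,q)=1$. That is, for every $\epsilon>0$ and every $\kappa>0$ there is $X_0=X_0(\epsilon,\kappa)$ such that for all real $X\geq X_0$, all primes $q\leq X^{\frac23}(\log X)^{\frac16-\epsilon}$ and all integers $a$ coprime to $q$, the ratio of the left-hand side to the right-hand side differs from $1$ by at most $\kappa$.
   Context: Here $\mu$ is the Möbius function, so $\mu^2$ is the indicator function of squarefree positive integers; $\varphi$ is Euler's totient function; $n$ runs over positive integers. *)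

theory Defs
  imports "HOL-Analysis.Analysis" "HOL-Number_Theory.Number_Theory"
    "HOL-Computational_Algebra.Squarefree"
begin

definition moebius_mu :: "nat \<Rightarrow> int" where
  "moebius_mu n = (if squarefree n then (-1) ^ card (prime_factors n) else 0)"

lemma moebius_mu_squared: "(moebius_mu n)\<^sup>2 = (if squarefree n then 1 else 0)"
  by (simp add: moebius_mu_def flip: power_mult)

end

theory Submission
  imports Defs "HOL-Real_Asymp.Real_Asymp"
begin

text \<open>The right-hand side is the average over \<open>b\<close> of the numbers of squarefree \<open>n \<le> X\<close> in the
  reduced classes \<open>b\<close> modulo \<open>q\<close>, and it is of order \<open>X / q\<close>; so it suffices that any two of these
  numbers differ by \<open>o(X / q)\<close>. Fix a large constant \<open>W\<close>. Integers not divisible by \<open>p\<^sup>2\<close> for any prime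
  \<open>p \<le> W\<close> are compared by a bounded shift, so only those \<open>n \<equiv> b\<close> divisible by \<open>p\<^sup>2\<close> for some prime
  \<open>p > W\<close> must be estimated. A prime \<open>p \<le> Y = K \<surd>q\<close> contributes at most \<open>X / (p\<^sup>2 q) + 1\<close>, in total at
  most \<open>X / (q W) + \<pi>(Y)\<close>. For \<open>p > Y\<close> write \<open>n = p\<^sup>2 m\<close> with \<open>m \<le> X / Y\<^sup>2 = X / (K\<^sup>2 q)\<close>; given \<open>m\<close>, the
  prime \<open>p\<close> lies in at most two classes modulo \<open>q\<close>. (If \<open>q \<le> \<surd>X / K\<close>, then \<open>Y = \<surd>X\<close> works.) Chebyshev's bound \<open>\<pi>(Y) = O(Y / log Y)\<close> makes
  \<open>\<pi>(Y)\<close> negligible against \<open>X / q\<close> as long as \<open>q \<le> X\<^bsup>2/3\<^esup> (log X)\<^bsup>2/3 - \<delta>\<^esup>\<close>.\<close>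

section \<open>Chebyshev's upper bound for the number of primes\<close>

lemma prod_primes_dvd:
  fixes P :: "nat set"
  assumes "finite P" "\<And>p. p \<in> P \<Longrightarrow> prime p" "\<And>p. p \<in> P \<Longrightarrow> p dvd n"
  shows "\<Prod>P dvd n"
  using assms
proof (induction P rule: finite_induct)
  case (insert p P)
  have "coprime p (\<Prod>P)"
    using insert by (intro prod_coprime_right) (auto intro!: primes_coprime)
  with insert show ?case
    by (auto intro!: divides_mult)
qed simp

text \<open>A prime in \<open>(n, 2n]\<close> divides \<open>fact (2 * n)\<close> but neither factor
  \<open>fact n\<close> of the denominator, so it survives in the quotient.\<close>

lemma prod_primes_between_dvd_central_binomial:
  "\<Prod>{p. prime p \<and> n < p \<and> p \<le> 2 * n} dvd (2 * n choose n)"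
proof (rule prod_primes_dvd)
  fix p assume "p \<in> {p. prime p \<and> n < p \<and> p \<le> 2 * n}"
  hence p: "prime p" "n < p" "p \<le> 2 * n" by auto
  have "fact n * fact n * (2 * n choose n) = (fact (2 * n) :: nat)"
    using binomial_fact_lemma[of n "2 * n"] by simp
  moreover have "p dvd fact (2 * n)" using p by (simp add: prime_dvd_fact_iff)
  ultimately have "p dvd fact n * fact n * (2 * n choose n)" by simp
  thus "p dvd (2 * n choose n)"
    using p by (auto simp: prime_dvd_mult_iff prime_dvd_fact_iff)
qed auto

text \<open>Passing from \<open>n = 2 ^ k\<close> to \<open>2 * n\<close> multiplies the primorial
  by the primes in \<open>(n, 2n]\<close>, whose product divides a central binomial coefficient and
  so is at most \<open>4 ^ n\<close>. The induction closes because
  \<open>4 ^ n * 4 ^ n = 4 ^ (2 * n)\<close>.\<close>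

lemma primorial_power_of_two_le: "\<Prod>{p::nat. prime p \<and> p \<le> 2 ^ k} \<le> 4 ^ (2 ^ k)"
proof (induction k)
  case 0
  have *: "{p::nat. prime p \<and> p \<le> 2 ^ 0} = {}" by (auto dest: prime_gt_1_nat)
  show ?case unfolding * by simp
next
  case (Suc k)
  define n :: nat where "n = 2 ^ k"
  have eq: "{p::nat. prime p \<and> p \<le> 2 ^ Suc k} =
      {p. prime p \<and> p \<le> n} \<union> {p. prime p \<and> n < p \<and> p \<le> 2 * n}"
    by (auto simp: n_def)
  have "\<Prod>{p. prime p \<and> n < p \<and> p \<le> 2 * n} \<le> (2 * n choose n)"
    by (rule dvd_imp_le[OF prod_primes_between_dvd_central_binomial]) simp
  also have "\<dots> \<le> 2 ^ (2 * n)"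
    using binomial_le_pow2 by blast
  finally have "\<Prod>{p. prime p \<and> n < p \<and> p \<le> 2 * n} \<le> 4 ^ n"
    by (simp add: power_mult)
  with Suc have "\<Prod>{p. prime p \<and> p \<le> n} * \<Prod>{p. prime p \<and> n < p \<and> p \<le> 2 * n} \<le> 4 ^ n * 4 ^ n"
    by (intro mult_mono) (auto simp: n_def)
  moreover have "(4::nat) ^ n * 4 ^ n = 4 ^ (2 ^ Suc k)"
    by (simp add: n_def mult_2 flip: power_add)
  ultimately show ?case
    by (subst eq, subst prod.union_disjoint) auto
qed

text \<open>Rounding \<open>n\<close> up to a power of two at most doubles it, which replaces the
  base 4 by 16.\<close>

lemma primorial_le:
  assumes "n > 0"
  shows "\<Prod>{p::nat. prime p \<and> p \<le> n} \<le> 16 ^ n"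
proof -
  obtain k where k: "2 ^ k \<le> n" "n < 2 ^ (k + 1)"
    using ex_power_ivl1[of 2 n] assms by auto
  have "\<Prod>{p::nat. prime p \<and> p \<le> n} \<le> \<Prod>{p::nat. prime p \<and> p \<le> 2 ^ (k + 1)}"
    using k by (intro dvd_imp_le prod_dvd_prod_subset prod_pos) (auto simp: prime_gt_0_nat)
  also have "\<dots> \<le> 4 ^ (2 ^ (k + 1))" by (rule primorial_power_of_two_le)
  also have "\<dots> \<le> (4::nat) ^ (2 * n)" using k by (intro power_increasing) auto
  also have "\<dots> = 16 ^ n" by (simp add: power_mult)
  finally show ?thesis .
qed

lemma finite_nat_real_le: "finite {n::nat. P n \<and> real n \<le> x}"
  by (rule finite_subset[of _ "{..nat \<lfloor>x\<rfloor>}"]) (auto simp: le_nat_floor)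

text \<open>Primes up to \<open>sqrt x\<close> are counted trivially. Each of the others exceeds
  \<open>sqrt x\<close>, and their product is bounded by the primorial; taking logarithms bounds how
  many there are.\<close>

lemma prime_count_le:
  fixes x :: real
  assumes "x > 1"
  shows "card {p. prime p \<and> real p \<le> x} \<le> sqrt x + 2 * ln 16 * x / ln x"
proof -
  define n where "n = nat \<lfloor>x\<rfloor>"
  define B where "B = {p. prime p \<and> real p \<le> x \<and> sqrt x < real p}"
  have n: "n > 0" "real n \<le> x" using assms by (auto simp: n_def) 
  have finB: "finite B" unfolding B_def using finite_nat_real_le[of prime x]
    by (rule rev_finite_subset) auto
  have "card {p. prime p \<and> real p \<le> x} \<le> card ({1..nat \<lfloor>sqrt x\<rfloor>} \<union> B)"
  proof (intro card_mono subsetI)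
    fix p assume p: "p \<in> {p. prime p \<and> real p \<le> x}"
    show "p \<in> {1..nat \<lfloor>sqrt x\<rfloor>} \<union> B"
    proof (cases "real p \<le> sqrt x")
      case True
      with p show ?thesis by (simp add: le_nat_floor Suc_leI prime_gt_0_nat)
    next
      case False
      with p show ?thesis by (simp add: B_def)
    qed
  qed (use finB in simp)
  also have "\<dots> \<le> nat \<lfloor>sqrt x\<rfloor> + card B" by (rule order.trans[OF card_Un_le]) simp
  finally have "card {p. prime p \<and> real p \<le> x} \<le> nat \<lfloor>sqrt x\<rfloor> + card B" .
  hence 1: "real (card {p. prime p \<and> real p \<le> x}) \<le> sqrt x + card B"
    using of_nat_floor[of "sqrt x"] assms real_sqrt_ge_zero[of x] by linarith
  have "sqrt x ^ card B = (\<Prod>p\<in>B. sqrt x)" by simp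
  also have "\<dots> \<le> (\<Prod>p\<in>B. real p)" using assms by (intro prod_mono) (auto simp: B_def)
  also have "\<dots> = real (\<Prod>B)" by simp
  also have "\<Prod>B \<le> \<Prod>{p::nat. prime p \<and> p \<le> n}"
    by (intro dvd_imp_le prod_dvd_prod_subset prod_pos)
       (auto simp: B_def n_def le_nat_floor prime_gt_0_nat)
  also have "\<dots> \<le> 16 ^ n" using n by (intro primorial_le) auto
  finally have "sqrt x ^ card B \<le> 16 ^ n" by simp
  hence "ln (sqrt x ^ card B) \<le> ln (16 ^ n)" using assms by (subst ln_le_cancel_iff) auto
  hence "card B * (ln x / 2) \<le> n * ln 16" using assms by (simp add: ln_realpow ln_sqrt)
  also have "\<dots> \<le> x * ln 16" using n by (intro mult_right_mono) auto
  finally have "card B \<le> 2 * ln 16 * x / ln x" using assms by (simp add: field_simps)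
  with 1 show ?thesis by linarith
qed

section \<open>Elementary counting in residue classes\<close>

text \<open>Each term is at most \<open>1 / (d - 1) - 1 / d\<close>, and these differences
  telescope.\<close>

lemma sum_inverse_squares_le:
  assumes "W > 0"
  shows "(\<Sum>d\<in>{W<..R}. 1 / real d ^ 2) \<le> 1 / real W"
proof (cases "W \<le> R")
  case True
  hence "(\<Sum>d\<in>{W<..R}. 1 / real d ^ 2) \<le> 1 / real W - 1 / real R"
  proof (induction R rule: dec_induct)
    case (step R)
    have "{W<..Suc R} = insert (Suc R) {W<..R}" using step by auto
    moreover have "1 / real (Suc R) ^ 2 \<le> 1 / (real R * real (Suc R))"
      using step assms by (intro divide_left_mono) (auto simp: power2_eq_square)
    moreover have "1 / (real R * real (Suc R)) = 1 / real R - 1 / real (Suc R)"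
      using step assms by (simp add: field_simps)
    ultimately show ?case using step by simp
  qed simp
  also have "\<dots> \<le> 1 / real W" by simp
  finally show ?thesis .
qed auto

text \<open>Cutting the interval, from \<open>l + 1\<close> on, into blocks of \<open>q\<close>
  consecutive integers puts at most one element of \<open>A\<close> into each block; the blocks are
  numbered from 0 to at most \<open>h div q\<close>.\<close>

lemma card_pairwise_cong_le:
  fixes A :: "nat set"
  assumes "A \<subseteq> {l<..l+h}" "\<And>u v. u \<in> A \<Longrightarrow> v \<in> A \<Longrightarrow> [u = v] (mod q)" "q > 0"
  shows "card A \<le> h div q + 1"
proof -
  have "inj_on (\<lambda>n. (n - l - 1) div q) A"
  proof (rule inj_onI)
    fix u v assume uv: "u \<in> A" "v \<in> A" "(u - l - 1) div q = (v - l - 1) div q"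
    obtain u' v' where e: "u = u' + (l + 1)" "v = v' + (l + 1)"
      using uv assms(1) by (metis add.commute greaterThanAtMost_iff less_iff_Suc_add Suc_eq_plus1 add.assoc subsetD)
    have "[u' = v'] (mod q)" using assms(2)[OF uv(1,2)] unfolding e by (simp only: cong_add_rcancel_nat)
    moreover have "u' div q = v' div q" using uv(3) e by simp
    ultimately have "u' = v'" unfolding cong_def by (metis div_mult_mod_eq)
    thus "u = v" using e by simp
  qed
  hence "card A = card ((\<lambda>n. (n - l - 1) div q) ` A)" by (simp add: card_image)
  also have "\<dots> \<le> card {..h div q}"
  proof (intro card_mono image_subsetI)
    fix n assume "n \<in> A"
    hence "n \<le> l + h" using assms(1) by auto
    thus "(n - l - 1) div q \<in> {..h div q}" by (simp add: div_le_mono)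
  qed simp
  finally show ?thesis by simp
qed

text \<open>If \<open>p\<^sup>2 * m\<close> lies in a reduced class then \<open>p\<close> is
  invertible modulo \<open>q\<close>, so all cofactors \<open>m\<close> lie in a single class,
  within an interval of length \<open>N div p\<^sup>2\<close>.\<close>

lemma card_multiples_of_square_cong_le:
  assumes q: "prime q" and a: "coprime a (int q)" and p: "p > 0"
  shows "real (card {n\<in>{1..N}. [int n = a] (mod int q) \<and> p\<^sup>2 dvd n})
           \<le> real N / (real q * real p ^ 2) + 1"
proof -
  \<comment> \<open>The bound is written \<open>0 + ...\<close> to match the interval
    \<open>{l<..l+h}\<close> of the block count.\<close>
  define A where "A = {m\<in>{0<..0 + N div p\<^sup>2}. [int (p\<^sup>2 * m) = a] (mod int q)}"
  have "{n\<in>{1..N}. [int n = a] (mod int q) \<and> p\<^sup>2 dvd n} \<subseteq> (\<lambda>m. p\<^sup>2 * m) ` A"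
  proof
    fix n assume n: "n \<in> {n\<in>{1..N}. [int n = a] (mod int q) \<and> p\<^sup>2 dvd n}"
    then obtain m where "n = p\<^sup>2 * m" by auto
    with n p show "n \<in> (\<lambda>m. p\<^sup>2 * m) ` A"
      by (auto simp: A_def less_eq_div_iff_mult_less_eq mult.commute intro!: Nat.gr0I)
  qed
  hence "card {n\<in>{1..N}. [int n = a] (mod int q) \<and> p\<^sup>2 dvd n} \<le> card A"
    by (rule surj_card_le[rotated]) (simp add: A_def)
  also have "card A \<le> (N div p\<^sup>2) div q + 1"
  proof (rule card_pairwise_cong_le)
    fix u v assume "u \<in> A" "v \<in> A"
    hence *: "[int (p\<^sup>2 * u) = a] (mod int q)" "[int (p\<^sup>2 * v) = a] (mod int q)"
      by (auto simp: A_def)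
    have "coprime (int (p\<^sup>2 * u)) (int q)" using a *(1) by (meson cong_imp_coprime cong_sym)
    hence "coprime (p\<^sup>2) q" by simp
    moreover have "[p\<^sup>2 * u = p\<^sup>2 * v] (mod q)"
      using * by (metis cong_int_iff cong_sym cong_trans)
    ultimately show "[u = v] (mod q)" by (simp add: cong_mult_lcancel_nat)
  qed (use prime_gt_0_nat[OF q] in \<open>auto simp: A_def\<close>)
  also have "(N div p\<^sup>2) div q = N div (p\<^sup>2 * q)" by (simp add: div_mult2_eq)
  finally have "real (card {n\<in>{1..N}. [int n = a] (mod int q) \<and> p\<^sup>2 dvd n}) \<le> real (N div (p\<^sup>2 * q)) + 1"
    by linarith
  also have "real (N div (p\<^sup>2 * q)) \<le> real N / real (p\<^sup>2 * q)"
    by (rule of_nat_div_le_of_nat)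
  finally show ?thesis by (simp add: mult.commute)
qed

text \<open>Modulo a prime, any solution \<open>d\<close> is congruent to plus or minus a fixed
  solution \<open>d0\<close>. Each of these two classes meets \<open>{1..R}\<close> at most
  \<open>R div q + 1\<close> times.\<close>

lemma card_square_roots_cong_le:
  assumes q: "prime q" and a: "coprime a (int q)"
  shows "card {d\<in>{1..R}. [int (d\<^sup>2 * m) = a] (mod int q)} \<le> 2 * (R div q + 1)"
proof (cases "\<exists>d0. [int (d0\<^sup>2 * m) = a] (mod int q)")
  case True
  then obtain d0 where d0: "[int (d0\<^sup>2 * m) = a] (mod int q)" by blast
  define A where "A = {d\<in>{1..R}. [int d = int d0] (mod int q)}"
  define B where "B = {d\<in>{1..R}. [int d = - int d0] (mod int q)}"
  have q0: "q > 0" using q prime_gt_0_nat by blast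
  have "{d\<in>{1..R}. [int (d\<^sup>2 * m) = a] (mod int q)} \<subseteq> A \<union> B"
  proof
    fix d assume d: "d \<in> {d\<in>{1..R}. [int (d\<^sup>2 * m) = a] (mod int q)}"
    \<comment> \<open>Solvability with a reduced class on the right makes \<open>m\<close> prime to
      \<open>q\<close>, so it can be cancelled below.\<close>
    have "coprime (int (d0\<^sup>2 * m)) (int q)" using a d0 by (meson cong_imp_coprime cong_sym)
    hence "coprime m q" by simp
    hence m: "\<not> int q dvd int m"
      using q by (metis coprime_absorb_right int_dvd_int_iff not_prime_unit)
    have "[int (d\<^sup>2 * m) = int (d0\<^sup>2 * m)] (mod int q)"
      using d cong_trans[OF _ cong_sym[OF d0]] by blast
    hence "int q dvd int (d\<^sup>2 * m) - int (d0\<^sup>2 * m)" by (simp only: cong_iff_dvd_diff)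
    also have "\<dots> = (int d - int d0) * (int d + int d0) * int m"
      by (simp add: algebra_simps power2_eq_square)
    finally have "int q dvd int d - int d0 \<or> int q dvd int d + int d0"
      using m q by (simp add: prime_dvd_mult_iff)
    thus "d \<in> A \<union> B" using d by (auto simp: A_def B_def cong_iff_dvd_diff)
  qed
  hence "card {d\<in>{1..R}. [int (d\<^sup>2 * m) = a] (mod int q)} \<le> card (A \<union> B)"
    by (intro card_mono) (auto simp: A_def B_def)
  also have "\<dots> \<le> card A + card B" by (rule card_Un_le)
  also have "card A \<le> R div q + 1"
  proof (rule card_pairwise_cong_le[where l = 0])
    fix u v assume "u \<in> A" "v \<in> A"
    thus "[u = v] (mod q)"
      unfolding A_def mem_Collect_eq by (metis cong_int_iff cong_sym cong_trans)
  qed (use q0 in \<open>auto simp: A_def\<close>)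
  also have "card B \<le> R div q + 1"
  proof (rule card_pairwise_cong_le[where l = 0])
    fix u v assume "u \<in> B" "v \<in> B"
    thus "[u = v] (mod q)"
      unfolding B_def mem_Collect_eq by (metis cong_int_iff cong_sym cong_trans)
  qed (use q0 in \<open>auto simp: B_def\<close>)
  finally show ?thesis by simp
next
  case False
  hence *: "{d\<in>{1..R}. [int (d\<^sup>2 * m) = a] (mod int q)} = {}" by blast
  show ?thesis unfolding * by simp
qed


section \<open>Integers divisible by the square of a large prime\<close>

text \<open>The exceptional \<open>n = p\<^sup>2 * m\<close> are sorted by \<open>p\<close> when
  \<open>p\<close> is at most \<open>Y\<close>, and by \<open>m\<close> otherwise. In the second
  case \<open>m\<close> is at most \<open>N / Y\<^sup>2\<close>, and \<open>p\<close> is a root, at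
  most \<open>sqrt N\<close>, of a quadratic congruence depending only on \<open>m\<close>.\<close>

lemma card_large_square_divisor_le:
  fixes Y :: real
  assumes q: "prime q" and a: "coprime a (int q)" and W: "W > 0" and Y: "Y > 0"
  shows "real (card {n\<in>{1..N}. [int n = a] (mod int q) \<and> (\<exists>p. prime p \<and> W < p \<and> p\<^sup>2 dvd n)})
           \<le> real N / (real q * real W) + real (card {p. prime p \<and> real p \<le> Y})
             + real N / Y\<^sup>2 * (2 * (sqrt (real N) / real q + 1))"
proof -
  define P where "P = {p. prime p \<and> W < p \<and> p \<le> N \<and> real p \<le> Y}"
  define S where "S p = {n\<in>{1..N}. [int n = a] (mod int q) \<and> p\<^sup>2 dvd n}" for p
  define R where "R = nat \<lfloor>sqrt (real N)\<rfloor>"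
  define M where "M = nat \<lfloor>real N / Y\<^sup>2\<rfloor>"
  define T where "T m = {d\<in>{1..R}. [int (d\<^sup>2 * m) = a] (mod int q)}" for m
  define E where "E = {n\<in>{1..N}. [int n = a] (mod int q) \<and> (\<exists>p. prime p \<and> W < p \<and> p\<^sup>2 dvd n)}"
  have finP: "finite P" by (rule finite_subset[of _ "{..N}"]) (auto simp: P_def)
  have "E \<subseteq> (\<Union>p\<in>P. S p) \<union> (\<Union>m\<in>{1..M}. (\<lambda>d. d\<^sup>2 * m) ` T m)"
  proof
    fix n assume "n \<in> E"
    then obtain p where n: "1 \<le> n" "n \<le> N" "[int n = a] (mod int q)"
      and p: "prime p" "W < p" "p\<^sup>2 dvd n" by (auto simp: E_def)
    from p obtain m where m: "n = p\<^sup>2 * m" by auto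
    have m0: "m > 0" using n m by (intro Nat.gr0I) auto
    have "p\<^sup>2 \<le> N" using n p(3) by (meson dvd_imp_le le_trans less_le_trans zero_less_one)
    hence pN: "real p ^ 2 \<le> real N" by (metis of_nat_le_iff of_nat_power)
    hence "real p \<le> sqrt (real N)" by (rule real_le_rsqrt)
    hence pR: "p \<le> R" unfolding R_def by (rule le_nat_floor)
    have "p \<le> N" using \<open>p\<^sup>2 \<le> N\<close> by (meson le_trans self_le_power pos2 prime_ge_1_nat p(1))
    show "n \<in> (\<Union>p\<in>P. S p) \<union> (\<Union>m\<in>{1..M}. (\<lambda>d. d\<^sup>2 * m) ` T m)"
    proof (cases "real p \<le> Y")
      case True
      hence "p \<in> P" "n \<in> S p" using p n \<open>p \<le> N\<close> by (auto simp: P_def S_def)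
      thus ?thesis by blast
    next
      case False
      have "Y\<^sup>2 * real m \<le> real p ^ 2 * real m"
        using False Y by (intro mult_right_mono power_mono) auto
      also have "\<dots> = real n" by (simp add: m)
      also have "\<dots> \<le> real N" using n by simp
      finally have "real m \<le> real N / Y\<^sup>2" using Y by (simp add: field_simps)
      hence "m \<le> M" unfolding M_def by (rule le_nat_floor)
      moreover have "p \<in> T m" using pR n prime_gt_0_nat[OF p(1)] unfolding T_def m by simp
      ultimately show ?thesis using m m0 by (intro UnI2 UN_I[of m]) auto
    qed
  qed
  hence "card E \<le> card ((\<Union>p\<in>P. S p) \<union> (\<Union>m\<in>{1..M}. (\<lambda>d. d\<^sup>2 * m) ` T m))"
    using finP by (intro card_mono) (auto simp: S_def T_def)
  also have "\<dots> \<le> card (\<Union>p\<in>P. S p) + card (\<Union>m\<in>{1..M}. (\<lambda>d. d\<^sup>2 * m) ` T m)"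
    by (rule card_Un_le)
  also have "card (\<Union>p\<in>P. S p) \<le> (\<Sum>p\<in>P. card (S p))" by (rule card_UN_le[OF finP])
  also have "card (\<Union>m\<in>{1..M}. (\<lambda>d. d\<^sup>2 * m) ` T m) \<le> (\<Sum>m\<in>{1..M}. card ((\<lambda>d. d\<^sup>2 * m) ` T m))"
    by (rule card_UN_le) simp
  also have "\<dots> \<le> (\<Sum>m\<in>{1..M}. 2 * (R div q + 1))"
    unfolding T_def
    by (intro sum_mono order.trans[OF card_image_le card_square_roots_cong_le[OF q a]]) simp
  finally have "card E \<le> (\<Sum>p\<in>P. card (S p)) + M * (2 * (R div q + 1))" by simp
  hence "real (card E) \<le> real ((\<Sum>p\<in>P. card (S p)) + M * (2 * (R div q + 1)))"
    by (simp only: of_nat_le_iff)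
  hence 1: "real (card E) \<le> (\<Sum>p\<in>P. real (card (S p))) + real M * (2 * (real (R div q) + 1))"
    by (simp add: algebra_simps)
  have "(\<Sum>p\<in>P. real (card (S p))) \<le> (\<Sum>p\<in>P. real N / (real q * real p ^ 2) + 1)"
    unfolding S_def P_def by (intro sum_mono card_multiples_of_square_cong_le[OF q a]) auto
  also have "\<dots> = real N / real q * (\<Sum>p\<in>P. 1 / real p ^ 2) + real (card P)"
    by (simp add: sum.distrib sum_distrib_left)
  also have "\<dots> \<le> real N / real q * (1 / real W) + real (card P)"
  proof (intro add_right_mono mult_left_mono)
    \<comment> \<open>Primality is dropped here: the sum over all integers above \<open>W\<close> is
      already small enough.\<close>
    have "(\<Sum>p\<in>P. 1 / real p ^ 2) \<le> (\<Sum>p\<in>{W<..N}. 1 / real p ^ 2)"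
      by (intro sum_mono2) (auto simp: P_def)
    also have "\<dots> \<le> 1 / real W" using W by (rule sum_inverse_squares_le)
    finally show "(\<Sum>p\<in>P. 1 / real p ^ 2) \<le> 1 / real W" .
  qed simp
  also have "card P \<le> card {p. prime p \<and> real p \<le> Y}"
    by (intro card_mono finite_nat_real_le) (auto simp: P_def)
  finally have 2: "(\<Sum>p\<in>P. real (card (S p))) \<le>
      real N / (real q * real W) + real (card {p. prime p \<and> real p \<le> Y})"
    by simp
  have "real (R div q) \<le> real R / real q" by (rule of_nat_div_le_of_nat)
  also have "\<dots> \<le> sqrt (real N) / real q"
    unfolding R_def by (intro divide_right_mono of_nat_floor) auto
  finally have "real M * (2 * (real (R div q) + 1)) \<le> real N / Y\<^sup>2 * (2 * (sqrt (real N) / real q + 1))"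
    unfolding M_def by (intro mult_mono of_nat_floor) auto
  with 1 2 show ?thesis unfolding E_def by linarith
qed

text \<open>Adding a suitable multiple of the squares of the small primes other than \<open>q\<close> moves one residue
  class modulo \<open>q\<close> onto the other without affecting divisibility by those squares.\<close>

lemma card_no_small_square_divisor_shift:
  assumes q: "prime q" and b: "coprime b (int q)"
  shows "card {n\<in>{1..N}. [int n = a] (mod int q) \<and> (\<forall>p. prime p \<longrightarrow> p \<le> W \<longrightarrow> \<not> p\<^sup>2 dvd n)}
       \<le> card {n\<in>{1..N}. [int n = b] (mod int q) \<and> (\<forall>p. prime p \<longrightarrow> p \<le> W \<longrightarrow> \<not> p\<^sup>2 dvd n)}
         + (fact W)\<^sup>2 + 1"
    (is "card ?A \<le> card ?B + _ + 1")
proof -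
  define P where "P = {p. prime p \<and> p \<le> W \<and> p \<noteq> q}"
  define Q where "Q = (\<Prod>p\<in>P. p\<^sup>2)"
  have finP: "finite P" by (rule finite_subset[of _ "{..W}"]) (auto simp: P_def)
  have q0: "q > 0" using q prime_gt_0_nat by blast
  have Qdvd: "p\<^sup>2 dvd Q" if "p \<in> P" for p
    unfolding Q_def using finP that by (rule dvd_prodI)
  \<comment> \<open>This bounds the modulus \<open>Q\<close> independently of \<open>q\<close>,
    which keeps the comparison uniform.\<close>
  have "Q dvd (\<Prod>p\<in>{1..W}. p\<^sup>2)" unfolding Q_def
    by (rule prod_dvd_prod_subset) (auto simp: P_def Suc_leI prime_gt_0_nat)
  also have "(\<Prod>p\<in>{1..W}. p\<^sup>2) = (fact W)\<^sup>2"
    by (simp add: fact_prod prod_power_distrib)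
  finally have Qle: "Q \<le> (fact W)\<^sup>2" by (rule dvd_imp_le) simp
  have "coprime Q q" unfolding Q_def P_def
    by (rule prod_coprime_left) (use q in \<open>auto intro: primes_coprime\<close>)
  then obtain y where y: "[int Q * y = 1] (mod int q)"
    using cong_solve_coprime_int[of "int Q" "int q"] by auto
  \<comment> \<open>\<open>k\<close> solves \<open>Q * k = b - a\<close> modulo \<open>q\<close>;
    taking the residue below \<open>q\<close> makes \<open>h div q\<close> at most
    \<open>Q\<close>.\<close>
  define k where "k = nat ((y * (b - a)) mod int q)"
  have k: "int k = (y * (b - a)) mod int q" "k < q"
    using q0 by (auto simp: k_def nat_less_iff)
  define h where "h = Q * k"
  have "[int h = int Q * (y * (b - a))] (mod int q)"
    unfolding h_def of_nat_mult k(1) by (intro cong_mult) (auto simp: cong_def)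
  also have "int Q * (y * (b - a)) = int Q * y * (b - a)" by simp
  also have "[\<dots> = 1 * (b - a)] (mod int q)" by (intro cong_mult y) auto
  finally have h: "[int h = b - a] (mod int q)" by simp
  \<comment> \<open>\<open>C\<close> collects the shifted elements that overshoot \<open>N\<close>;
    there are at most \<open>h div q + 1\<close> of them.\<close>
  define C where "C = {n\<in>{N<..N+h}. [int n = b] (mod int q)}"
  have "(\<lambda>n. n + h) ` ?A \<subseteq> ?B \<union> C"
  proof
    fix l assume "l \<in> (\<lambda>n. n + h) ` ?A"
    then obtain n where n: "l = n + h" "1 \<le> n" "n \<le> N" "[int n = a] (mod int q)"
      "\<And>p. prime p \<Longrightarrow> p \<le> W \<Longrightarrow> \<not> p\<^sup>2 dvd n" by auto
    have "[int n + int h = a + (b - a)] (mod int q)" by (intro cong_add n h)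
    hence l: "[int l = b] (mod int q)" using n(1) by simp
    have "\<not> p\<^sup>2 dvd l" if p: "prime p" "p \<le> W" for p
    proof (cases "p = q")
      case True
      \<comment> \<open>The square of \<open>q\<close> is not built into the shift, but no element
        of a reduced class is divisible by \<open>q\<close>.\<close>
      have "coprime (int l) (int q)" using l b by (meson cong_imp_coprime cong_sym)
      hence "coprime l q" by simp
      hence "\<not> q dvd l" using q by (metis coprime_absorb_right not_prime_unit)
      thus ?thesis using True by (meson dvd_power dvd_trans pos2)
    next
      case False
      hence "p\<^sup>2 dvd h" using p Qdvd[of p] by (simp add: P_def h_def)
      thus ?thesis using n(1) n(5)[OF p] by (simp add: dvd_add_left_iff)
    qed
    thus "l \<in> ?B \<union> C" using n l by (auto simp: C_def)
  qed
  hence "card ((\<lambda>n. n + h) ` ?A) \<le> card (?B \<union> C)" by (intro card_mono) (auto simp: C_def)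
  also have "\<dots> \<le> card ?B + card C" by (rule card_Un_le)
  also have "card C \<le> h div q + 1"
  proof (rule card_pairwise_cong_le)
    fix u v assume "u \<in> C" "v \<in> C"
    thus "[u = v] (mod q)"
      unfolding C_def mem_Collect_eq by (metis cong_int_iff cong_sym cong_trans)
  qed (use q0 in \<open>auto simp: C_def\<close>)
  also have "h div q \<le> Q"
    using k(2) unfolding h_def by (metis div_le_mono less_imp_le mult_le_mono2 nonzero_mult_div_cancel_right q0 not_gr0)
  also note Qle
  also have "card ((\<lambda>n. n + h) ` ?A) = card ?A" by (rule card_image) simp
  finally show ?thesis by simp
qed

section \<open>Squarefree numbers in two classes compared\<close>

definition squarefree_class :: "nat \<Rightarrow> nat \<Rightarrow> int \<Rightarrow> nat set" where
  "squarefree_class N q a = {n\<in>{1..N}. [int n = a] (mod int q) \<and> squarefree n}"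

lemma squarefree_iff_no_prime_square:
  fixes n :: nat
  assumes "n > 0"
  shows "squarefree n \<longleftrightarrow> (\<forall>p. prime p \<longrightarrow> \<not> p\<^sup>2 dvd n)"
  using assms by (subst squarefree_factorial_semiring) auto

text \<open>Squarefreeness in the class of \<open>a\<close> is relaxed to the primes up to
  \<open>W\<close>, the relaxed sets are compared by the shift, and in the class of \<open>b\<close>
  the elements with a large square divisor are then removed.\<close>

lemma card_squarefree_class_le:
  fixes Y :: real
  assumes q: "prime q" and b: "coprime b (int q)" and W: "W > 0" and Y: "Y > 0"
  shows "real (card (squarefree_class N q a)) \<le> real (card (squarefree_class N q b))
           + (fact W)\<^sup>2 + 1
           + real N / (real q * real W) + real (card {p. prime p \<and> real p \<le> Y})
           + real N / Y\<^sup>2 * (2 * (sqrt (real N) / real q + 1))"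
proof -
  define L where "L c = {n\<in>{1..N}. [int n = c] (mod int q) \<and> (\<forall>p. prime p \<longrightarrow> p \<le> W \<longrightarrow> \<not> p\<^sup>2 dvd n)}" for c
  define E where "E = {n\<in>{1..N}. [int n = b] (mod int q) \<and> (\<exists>p. prime p \<and> W < p \<and> p\<^sup>2 dvd n)}"
  have "card (squarefree_class N q a) \<le> card (L a)"
    by (rule card_mono) (auto simp: L_def squarefree_class_def squarefree_iff_no_prime_square)
  also have "\<dots> \<le> card (L b) + (fact W)\<^sup>2 + 1"
    unfolding L_def by (rule card_no_small_square_divisor_shift[OF q b])
  also have "card (L b) \<le> card (squarefree_class N q b \<union> E)"
  proof (intro card_mono subsetI)
    fix n assume n: "n \<in> L b"
    show "n \<in> squarefree_class N q b \<union> E"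
    proof (cases "squarefree n")
      case False
      then obtain p where "prime p" "p\<^sup>2 dvd n"
        using n by (auto simp: L_def squarefree_iff_no_prime_square)
      with n have "W < p" by (auto simp: L_def not_le[symmetric])
      with n \<open>prime p\<close> \<open>p\<^sup>2 dvd n\<close> show ?thesis by (auto simp: L_def E_def)
    qed (use n in \<open>simp add: L_def squarefree_class_def\<close>)
  qed (simp add: squarefree_class_def E_def)
  also have "\<dots> \<le> card (squarefree_class N q b) + card E" by (rule card_Un_le)
  finally have "card (squarefree_class N q a) \<le> card (squarefree_class N q b) + card E + (fact W)\<^sup>2 + 1"
    by simp
  hence "real (card (squarefree_class N q a)) \<le> real (card (squarefree_class N q b) + card E + (fact W)\<^sup>2 + 1)"
    by (simp only: of_nat_le_iff)
  moreover note card_large_square_divisor_le[OF q b W Y, of N, folded E_def]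
  ultimately show ?thesis by simp
qed

section \<open>Squarefree numbers prime to the modulus: lower bound and splitting into
  classes\<close>

text \<open>Removing the multiples of \<open>d\<^sup>2\<close> for all \<open>d\<close> from 2 on
  costs at most the proportion \<open>1/4 + 1/2\<close>.\<close>

lemma card_squarefree_ge: "real N / 4 \<le> real (card {n\<in>{1..N}. squarefree n})"
proof -
  define S where "S d = {n\<in>{1..N}. d\<^sup>2 dvd n}" for d
  have S: "real (card (S d)) \<le> real N / real d ^ 2" if "d > 0" for d
  proof -
    have "S d \<subseteq> (\<lambda>m. d\<^sup>2 * m) ` {1..N div d\<^sup>2}"
    proof
      fix n assume n: "n \<in> S d"
      then obtain m where "n = d\<^sup>2 * m" by (auto simp: S_def)
      with n that show "n \<in> (\<lambda>m. d\<^sup>2 * m) ` {1..N div d\<^sup>2}"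
        by (auto simp: S_def less_eq_div_iff_mult_less_eq mult.commute Suc_leI intro!: Nat.gr0I)
    qed
    from surj_card_le[OF _ this] have "card (S d) \<le> N div d\<^sup>2" by simp
    also have "real (N div d\<^sup>2) \<le> real N / real (d\<^sup>2)" by (rule of_nat_div_le_of_nat)
    finally show ?thesis by simp
  qed
  have "{1..N} \<subseteq> {n\<in>{1..N}. squarefree n} \<union> (\<Union>d\<in>{1<..N}. S d)"
  proof
    fix n assume n: "n \<in> {1..N}"
    show "n \<in> {n\<in>{1..N}. squarefree n} \<union> (\<Union>d\<in>{1<..N}. S d)"
    proof (cases "squarefree n")
      case False
      then obtain p where p: "prime p" "p\<^sup>2 dvd n"
        using n by (auto simp: squarefree_iff_no_prime_square)
      have "p dvd n" using p(2) by (meson dvd_power dvd_trans pos2)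
      hence "p \<le> N" using n by (auto dest: dvd_imp_le)
      thus ?thesis using n p prime_gt_1_nat[OF p(1)] by (intro UnI2 UN_I[of p]) (auto simp: S_def)
    qed (use n in auto)
  qed
  hence "card {1..N} \<le> card ({n\<in>{1..N}. squarefree n} \<union> (\<Union>d\<in>{1<..N}. S d))"
    by (rule card_mono[rotated]) (auto simp: S_def)
  also have "\<dots> \<le> card {n\<in>{1..N}. squarefree n} + card (\<Union>d\<in>{1<..N}. S d)" by (rule card_Un_le)
  also have "card (\<Union>d\<in>{1<..N}. S d) \<le> (\<Sum>d\<in>{1<..N}. card (S d))" by (rule card_UN_le) simp
  finally have "real N \<le> real (card {n\<in>{1..N}. squarefree n} + (\<Sum>d\<in>{1<..N}. card (S d)))"
    by (simp only: of_nat_le_iff card_atLeastAtMost) simp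
  also have "\<dots> = real (card {n\<in>{1..N}. squarefree n}) + (\<Sum>d\<in>{1<..N}. real (card (S d)))" by simp
  also have "(\<Sum>d\<in>{1<..N}. real (card (S d))) \<le> (\<Sum>d\<in>{1<..N}. real N * (1 / real d ^ 2))"
    by (intro sum_mono) (use S in auto)
  also have "\<dots> = real N * (\<Sum>d\<in>{1<..N}. 1 / real d ^ 2)" by (simp add: sum_distrib_left)
  \<comment> \<open>The term \<open>d = 2\<close> is split off because the telescoping bound for the
    whole sum is 1, which would leave nothing.\<close>
  also have "(\<Sum>d\<in>{1<..N}. 1 / real d ^ 2) \<le> (\<Sum>d\<in>insert 2 {2<..N}. 1 / real d ^ 2)"
    by (intro sum_mono2) auto
  also have "\<dots> = 1 / 4 + (\<Sum>d\<in>{2<..N}. 1 / real d ^ 2)" by simp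
  also have "(\<Sum>d\<in>{2<..N}. 1 / real d ^ 2) \<le> 1 / real 2" by (rule sum_inverse_squares_le) simp
  finally show ?thesis by (simp add: mult_left_mono)
qed

text \<open>A squarefree number is either prime to \<open>q\<close> or \<open>q\<close> times a
  squarefree number prime to \<open>q\<close>, so those prime to \<open>q\<close> make up at least
  half.\<close>

lemma card_squarefree_coprime_ge:
  assumes q: "prime q"
  shows "real N / 8 \<le> real (card {n\<in>{1..N}. coprime n q \<and> squarefree n})"
proof -
  define S where "S = {n\<in>{1..N}. coprime n q \<and> squarefree n}"
  have q0: "q > 0" using q prime_gt_0_nat by blast
  have "{n\<in>{1..N}. squarefree n} \<subseteq> S \<union> (\<lambda>m. q * m) ` S"
  proof
    fix n assume n: "n \<in> {n\<in>{1..N}. squarefree n}"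
    show "n \<in> S \<union> (\<lambda>m. q * m) ` S"
    proof (cases "q dvd n")
      case True
      then obtain m where m: "n = q * m" by auto
      have "\<not> q\<^sup>2 dvd n" using n q by (auto simp: squarefree_iff_no_prime_square)
      hence "\<not> q dvd m" by (simp add: m power2_eq_square q0)
      hence "coprime m q" using q by (metis coprime_commute prime_imp_coprime)
      moreover have "squarefree m" using n m by (auto intro: squarefree_mono[of m n])
      moreover have "m \<ge> 1" using n m by (auto simp: Suc_leI intro!: Nat.gr0I)
      moreover have "m \<le> q * m" using q0 by simp
      hence "m \<le> N" using n m by (metis (no_types, lifting) atLeastAtMost_iff le_trans mem_Collect_eq)
      ultimately show ?thesis using m by (auto simp: S_def)
    next
      case False
      hence "coprime n q" using q by (metis coprime_commute prime_imp_coprime)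
      thus ?thesis using n by (auto simp: S_def)
    qed
  qed
  hence "card {n\<in>{1..N}. squarefree n} \<le> card (S \<union> (\<lambda>m. q * m) ` S)"
    by (rule card_mono[rotated]) (auto simp: S_def)
  also have "\<dots> \<le> card S + card ((\<lambda>m. q * m) ` S)" by (rule card_Un_le)
  also have "card ((\<lambda>m. q * m) ` S) \<le> card S" by (rule card_image_le) (simp add: S_def)
  finally show ?thesis using card_squarefree_ge[of N] unfolding S_def by linarith
qed

text \<open>For prime \<open>q\<close> the reduced classes are those of
  \<open>1, ..., q - 1\<close>. This exhibits the right-hand side of the theorem as an average of
  class counts.\<close>

lemma card_squarefree_coprime_eq_sum:
  assumes q: "prime q"
  shows "card {n\<in>{1..N}. coprime n q \<and> squarefree n} = (\<Sum>r\<in>{1..<q}. card (squarefree_class N q (int r)))"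
proof -
  have q1: "q > 1" using q prime_gt_1_nat by blast
  have "{n\<in>{1..N}. coprime n q \<and> squarefree n} = (\<Union>r\<in>{1..<q}. squarefree_class N q (int r))"
  proof (intro equalityI subsetI)
    fix n assume n: "n \<in> {n\<in>{1..N}. coprime n q \<and> squarefree n}"
    hence "\<not> q dvd n" using q by (metis (no_types, lifting) coprime_absorb_right mem_Collect_eq not_prime_unit)
    hence "n mod q \<in> {1..<q}" using q1 by (simp add: Suc_leI mod_greater_zero_iff_not_dvd)
    moreover have "n \<in> squarefree_class N q (int (n mod q))"
      using n by (simp add: squarefree_class_def cong_int_iff)
    ultimately show "n \<in> (\<Union>r\<in>{1..<q}. squarefree_class N q (int r))" by blast
  next
    fix n assume "n \<in> (\<Union>r\<in>{1..<q}. squarefree_class N q (int r))"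
    then obtain r where r: "1 \<le> r" "r < q" "[n = r] (mod q)" "n \<in> {1..N}" "squarefree n"
      by (auto simp: squarefree_class_def cong_int_iff)
    have "coprime r q" using r q by (metis coprime_commute less_le_trans nat_dvd_not_less prime_imp_coprime zero_less_one)
    hence "coprime n q" using r(3) by (meson cong_imp_coprime cong_sym)
    thus "n \<in> {n\<in>{1..N}. coprime n q \<and> squarefree n}" using r by simp
  qed
  moreover have "card (\<Union>r\<in>{1..<q}. squarefree_class N q (int r)) = (\<Sum>r\<in>{1..<q}. card (squarefree_class N q (int r)))"
  proof (rule card_UN_disjoint)
    show "\<forall>i\<in>{1..<q}. \<forall>j\<in>{1..<q}. i \<noteq> j \<longrightarrow> squarefree_class N q (int i) \<inter> squarefree_class N q (int j) = {}"
    proof (intro ballI impI equals0I)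
      fix i j n assume ij: "i \<in> {1..<q}" "j \<in> {1..<q}" "i \<noteq> j"
        and "n \<in> squarefree_class N q (int i) \<inter> squarefree_class N q (int j)"
      hence "[n = i] (mod q)" "[n = j] (mod q)" by (auto simp: squarefree_class_def cong_int_iff)
      hence "[i = j] (mod q)" by (meson cong_sym cong_trans)
      thus False using ij by (simp add: cong_less_modulus_unique_nat)
    qed
  qed (auto simp: squarefree_class_def)
  ultimately show ?thesis by simp
qed


section \<open>Choice of parameters and uniformity in the modulus\<close>

text \<open>The error of the comparison has four parts: the shift, the term with
  \<open>1 / W\<close>, the prime count and the tail over \<open>p > Y\<close>. Each is made at most
  a quarter of \<open>\<eta> * (X / q)\<close>, with \<open>Y\<close> depending on the size of
  \<open>q\<close>.\<close>

lemma squarefree_classes_close: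
  fixes \<eta> :: real
  assumes \<eta>: "\<eta> > 0"
  shows "eventually (\<lambda>X. \<forall>q a b. prime q \<longrightarrow> real q \<le> X powr (2/3) * ln X powr (1/6) \<longrightarrow>
           coprime b (int q) \<longrightarrow>
           real (card (squarefree_class (nat \<lfloor>X\<rfloor>) q a))
             \<le> real (card (squarefree_class (nat \<lfloor>X\<rfloor>) q b)) + \<eta> * (X / real q)) at_top"
proof -
  \<comment> \<open>\<open>W\<close> makes \<open>1 / W\<close> at most \<open>\<eta> / 4\<close>,
    and \<open>K\<close> makes the tail factor \<open>4 / K\<close> at most
    \<open>\<eta> / 4\<close>. Both, and hence the shift error \<open>C\<close>, depend on
    \<open>\<eta>\<close> alone.\<close>
  define W :: nat where "W = nat \<lceil>4 / \<eta>\<rceil> + 1"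
  define K :: real where "K = max 1 (16 / \<eta>)"
  define C :: real where "C = (fact W)\<^sup>2 + 1"
  have "4 / \<eta> \<le> real W" unfolding W_def using of_nat_ceiling[of "4 / \<eta>"] by simp
  moreover have "W > 0" by (simp add: W_def)
  ultimately have W: "W > 0" "1 / real W \<le> \<eta> / 4" using \<eta> by (auto simp: field_simps)
  have "K \<ge> 1" "16 / \<eta> \<le> K" by (simp_all add: K_def)
  hence K: "K \<ge> 1" "1 / K \<le> \<eta> / 16" using \<eta> by (auto simp: field_simps)
  \<comment> \<open>The three limits serve, in order, the shift error, the tail for small
    \<open>q\<close>, and the prime count for large \<open>q\<close>.\<close>
  have "eventually (\<lambda>X::real. C * (X powr (2/3) * ln X powr (1/6)) \<le> \<eta> / 4 * X) at_top"
    using \<eta> by real_asymp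
  moreover have "eventually (\<lambda>X::real. 16 * sqrt X \<le> \<eta> * X) at_top"
    using \<eta> by real_asymp
  moreover have "eventually (\<lambda>X::real. K * ln X powr (1/4) * (X powr (-1/8) + 8 * ln 16 / ln X) \<le> \<eta> / 4) at_top"
  proof -
    have "((\<lambda>X::real. K * ln X powr (1/4) * (X powr (-1/8) + 8 * ln 16 / ln X)) \<longlongrightarrow> 0) at_top"
      by real_asymp
    from order_tendstoD(2)[OF this, of "\<eta> / 4"] show ?thesis
      using \<eta> by (auto elim!: eventually_mono)
  qed
  moreover have "eventually (\<lambda>X::real. X > exp 1) at_top" by (rule eventually_gt_at_top)
  ultimately show ?thesis
  proof eventually_elim
    case (elim X)
    note C_le = elim(1) and sqrt_le = elim(2) and log_le = elim(3)
    have X1: "X > 1" using elim(4) one_le_exp_iff[of "1::real"] by linarith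
    have lnX: "ln X > 0" using X1 by simp
    show ?case
    proof (intro allI impI)
      fix q :: nat and a b :: int
      assume q: "prime q" and q_le: "real q \<le> X powr (2/3) * ln X powr (1/6)"
        and b: "coprime b (int q)"
      define N where "N = nat \<lfloor>X\<rfloor>"
      define D where "D = X / real q"
      have N: "real N \<le> X" using X1 by (simp add: N_def)
      have q0: "real q > 0" using q prime_gt_0_nat by simp
      have D0: "D > 0" using X1 q0 by (simp add: D_def)
      have "C * real q \<le> C * (X powr (2/3) * ln X powr (1/6))"
        by (intro mult_left_mono q_le) (auto simp: C_def)
      also note C_le
      finally have 1: "C \<le> \<eta> / 4 * D" using q0 by (simp add: D_def field_simps)
      have "real N / (real q * real W) \<le> D * (1 / real W)"
        using N q0 W by (simp add: D_def divide_right_mono)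
      also have "\<dots> \<le> D * (\<eta> / 4)" using W D0 by (intro mult_left_mono) auto
      finally have 2: "real N / (real q * real W) \<le> \<eta> / 4 * D" by (simp add: mult.commute)
      have main: "real (card (squarefree_class N q a)) \<le> real (card (squarefree_class N q b)) + \<eta> * D"
        if Y: "Y > 0" and count: "real (card {p. prime p \<and> real p \<le> Y}) \<le> \<eta> / 4 * D"
          and tail: "X / Y\<^sup>2 * (2 * (sqrt X / real q + 1)) \<le> \<eta> / 4 * D" for Y :: real
      proof -
        have "real N / Y\<^sup>2 * (2 * (sqrt (real N) / real q + 1)) \<le> X / Y\<^sup>2 * (2 * (sqrt X / real q + 1))"
          using N X1 q0 by (intro mult_mono divide_right_mono add_right_mono) auto
        with card_squarefree_class_le[OF q b W(1) Y, of N a] 1 2 count tail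
        show ?thesis unfolding C_def by linarith
      qed
      show "real (card (squarefree_class (nat \<lfloor>X\<rfloor>) q a))
          \<le> real (card (squarefree_class (nat \<lfloor>X\<rfloor>) q b)) + \<eta> * (X / real q)"
      proof (cases "real q * K \<le> sqrt X")
        \<comment> \<open>With \<open>Y = sqrt X\<close> the factor \<open>X / Y\<^sup>2\<close> is
          1, and the trivial prime count \<open>sqrt X\<close> is at most \<open>D / K\<close>
          because \<open>q * K\<close> is at most \<open>sqrt X\<close>.\<close>
        case True
        show ?thesis
        proof (rule main[of "sqrt X", unfolded N_def D_def])
          show "sqrt X > 0" using X1 by simp
          have "card {p. prime p \<and> real p \<le> sqrt X} \<le> card {1..nat \<lfloor>sqrt X\<rfloor>}"
            by (intro card_mono) (auto simp: Suc_leI prime_gt_0_nat le_nat_floor)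
          hence "real (card {p. prime p \<and> real p \<le> sqrt X}) \<le> real (nat \<lfloor>sqrt X\<rfloor>)" by simp
          also have "\<dots> \<le> sqrt X" using X1 by (intro of_nat_floor) simp
          also have "sqrt X * (real q * K) \<le> sqrt X * sqrt X"
            using True X1 by (intro mult_left_mono) auto
          hence "sqrt X \<le> D * (1 / K)" using X1 q0 K by (simp add: D_def field_simps)
          also have "\<dots> \<le> D * (\<eta> / 4)" using K D0 \<eta> by (intro mult_left_mono) auto
          finally show "real (card {p. prime p \<and> real p \<le> sqrt X}) \<le> \<eta> / 4 * (X / real q)"
            by (simp add: D_def mult_ac)
          have "real q \<le> real q * K" using K q0 by simp
          hence "real q \<le> sqrt X" using True by (rule order.trans)
          hence "2 * (sqrt X + real q) \<le> 4 * sqrt X" by simp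
          also have "\<dots> \<le> \<eta> / 4 * X" using sqrt_le by linarith
          finally have "2 * (sqrt X + real q) / real q \<le> \<eta> / 4 * X / real q"
            using q0 by (intro divide_right_mono) auto
          moreover have "X / (sqrt X)\<^sup>2 * (2 * (sqrt X / real q + 1)) = 2 * (sqrt X + real q) / real q"
            using X1 q0 by (simp add: add_divide_distrib)
          ultimately show "X / (sqrt X)\<^sup>2 * (2 * (sqrt X / real q + 1)) \<le> \<eta> / 4 * (X / real q)"
            by simp
        qed
      next
        case False
        \<comment> \<open>This choice leaves at most \<open>D / K\<^sup>2\<close> cofactors, and
          each admits at most \<open>2 * (sqrt X / q + 1)\<close> primes, which is at most
          \<open>4 * K\<close>; the tail is thus at most \<open>4 * D / K\<close>.\<close>
        define Y where "Y = K * sqrt (real q)"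
        have Y0: "Y > 0" using K q0 by (simp add: Y_def)
        have Ysq: "Y\<^sup>2 = K\<^sup>2 * real q" using q0 by (simp add: Y_def power_mult_distrib)
        \<comment> \<open>Since \<open>q\<close> is large here, \<open>Y\<close> is at least the
          fourth root of \<open>X\<close>, so \<open>ln Y\<close> may be replaced by
          \<open>ln X / 4\<close> in the prime count.\<close>
        have "real q * K * 1 \<le> real q * K * K"
          using K q0 by (intro mult_left_mono) auto
        hence "sqrt X \<le> real q * K * K" using False by linarith
        hence "sqrt X \<le> Y\<^sup>2" unfolding Ysq by (simp add: power2_eq_square mult_ac)
        hence Y_sqrt: "sqrt (sqrt X) \<le> Y" using real_sqrt_le_mono[of "sqrt X" "Y\<^sup>2"] Y0 by simp
        have root: "sqrt (sqrt X) = X powr (1/4)"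
          using X1 by (simp add: powr_half_sqrt[symmetric] powr_powr)
        have Yge: "X powr (1/4) \<le> Y" using Y_sqrt root by simp
        have "1 < X powr (1/4)" using X1 by simp
        hence Y1: "Y > 1" using Yge by linarith
        have "ln (X powr (1/4)) \<le> ln Y" using Yge X1 Y0 by (subst ln_le_cancel_iff) auto
        hence lnY: "ln X / 4 \<le> ln Y" using X1 by (simp add: ln_powr)
        have "sqrt Y = Y * Y powr (-1/2)"
          using Y0 by (simp add: powr_half_sqrt[symmetric] powr_mult_base)
        also have "Y powr (-1/2) \<le> (X powr (1/4)) powr (-1/2)"
          using Yge X1 by (intro powr_mono2') auto
        also have "\<dots> = X powr (-1/8)" by (simp add: powr_powr)
        finally have sqrtY: "sqrt Y \<le> Y * X powr (-1/8)" using Y0 by simp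
        have "2 * ln 16 * Y / ln Y \<le> 2 * ln 16 * Y / (ln X / 4)"
          using lnY lnX Y1 by (intro divide_left_mono mult_pos_pos) auto
        hence "real (card {p. prime p \<and> real p \<le> Y}) \<le> Y * (X powr (-1/8) + 8 * ln 16 / ln X)"
          using prime_count_le[OF Y1] sqrtY by (simp add: algebra_simps)
        hence "real (card {p. prime p \<and> real p \<le> Y}) * real q
            \<le> Y * (X powr (-1/8) + 8 * ln 16 / ln X) * real q"
          using q0 by (intro mult_right_mono) auto
        also have "\<dots> = real q powr (3/2) * (K * (X powr (-1/8) + 8 * ln 16 / ln X))"
        proof -
          have "real q powr (3/2) = real q powr (1 + 1/2)" by simp
          also have "\<dots> = real q * sqrt (real q)"
            using q0 by (simp only: powr_add powr_half_sqrt) simp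
          finally show ?thesis by (simp add: Y_def mult_ac)
        qed
        also have "\<dots> \<le> X * ln X powr (1/4) * (K * (X powr (-1/8) + 8 * ln 16 / ln X))"
        proof (rule mult_right_mono)
          \<comment> \<open>The range of \<open>q\<close> enters here: the exponents
            \<open>2/3\<close> and \<open>1/6\<close> become 1 and \<open>1/4\<close>, and the
            logarithm saved by Chebyshev's bound outweighs \<open>ln X powr (1/4)\<close>.\<close>
          have "real q powr (3/2) \<le> (X powr (2/3) * ln X powr (1/6)) powr (3/2)"
            using q_le q0 by (intro powr_mono2) auto
          also have "\<dots> = X * ln X powr (1/4)"
            using X1 lnX by (simp add: powr_mult powr_powr)
          finally show "real q powr (3/2) \<le> X * ln X powr (1/4)" .
        qed (use K lnX in auto)
        also have "X * ln X powr (1/4) * (K * (X powr (-1/8) + 8 * ln 16 / ln X))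
            = X * (K * ln X powr (1/4) * (X powr (-1/8) + 8 * ln 16 / ln X))"
          by (simp add: mult_ac)
        also have "\<dots> \<le> X * (\<eta> / 4)" using log_le X1 by (intro mult_left_mono) auto
        finally have count: "real (card {p. prime p \<and> real p \<le> Y}) \<le> \<eta> / 4 * D"
          using q0 by (simp add: D_def field_simps)
        have "sqrt X / real q \<le> K" using False q0 by (simp add: field_simps)
        hence "2 * (sqrt X / real q + 1) \<le> 2 * (K + K)"
          using K by (intro mult_left_mono add_mono) auto
        hence "X / Y\<^sup>2 * (2 * (sqrt X / real q + 1)) \<le> X / Y\<^sup>2 * (2 * (K + K))"
          using X1 by (intro mult_left_mono) auto
        also have "\<dots> = 4 * D * (1 / K)"
          unfolding Ysq D_def using K q0 by (simp add: field_simps power2_eq_square)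
        also have "\<dots> \<le> 4 * D * (\<eta> / 16)" using K D0 by (intro mult_left_mono) auto
        finally have tail: "X / Y\<^sup>2 * (2 * (sqrt X / real q + 1)) \<le> \<eta> / 4 * D" by (simp add: mult.commute[of D])
        show ?thesis using main[OF Y0 count tail] by (simp add: N_def D_def)
      qed
    qed
  qed
qed

section \<open>Averaging over the reduced classes\<close>

theorem mainTheorem5:
  fixes \<epsilon> \<kappa> :: real
  assumes "\<epsilon> > 0" and "\<kappa> > 0"
  shows "\<exists>X0::real. \<forall>X\<ge>X0. \<forall>(q::nat) (a::int).
           prime q \<longrightarrow> real q \<le> X powr (2/3) * (ln X) powr (1/6 - \<epsilon>) \<longrightarrow> coprime a (int q) \<longrightarrow>
           \<bar>(\<Sum>n | 0 < n \<and> real n \<le> X \<and> [int n = a] (mod int q). real_of_int ((moebius_mu n)\<^sup>2))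
              / (1 / real (totient q) *
                 (\<Sum>n | 0 < n \<and> real n \<le> X \<and> coprime n q. real_of_int ((moebius_mu n)\<^sup>2)))
            - 1\<bar> \<le> \<kappa>"
proof -
  \<comment> \<open>The 16 matches the lower bound \<open>X / 16\<close> for \<open>S\<close>, which
    comes from the density \<open>1/8\<close> and \<open>N\<close> being at least
    \<open>X / 2\<close>.\<close>
  define \<eta> where "\<eta> = \<kappa> / 16"
  have \<eta>: "\<eta> > 0" using assms by (simp add: \<eta>_def)
  obtain X1 :: real where close: "\<And>X q a b. X \<ge> X1 \<Longrightarrow> prime q \<Longrightarrow>
      real q \<le> X powr (2/3) * ln X powr (1/6) \<Longrightarrow> coprime b (int q) \<Longrightarrow>
      real (card (squarefree_class (nat \<lfloor>X\<rfloor>) q a))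
        \<le> real (card (squarefree_class (nat \<lfloor>X\<rfloor>) q b)) + \<eta> * (X / real q)"
    using squarefree_classes_close[OF \<eta>] unfolding eventually_at_top_linorder by blast
  have "\<bar>(\<Sum>n | 0 < n \<and> real n \<le> X \<and> [int n = a] (mod int q). real_of_int ((moebius_mu n)\<^sup>2))
              / (1 / real (totient q) *
                 (\<Sum>n | 0 < n \<and> real n \<le> X \<and> coprime n q. real_of_int ((moebius_mu n)\<^sup>2)))
            - 1\<bar> \<le> \<kappa>"
    if X: "X \<ge> max X1 (exp 1)" and q: "prime q"
      and q_le: "real q \<le> X powr (2/3) * ln X powr (1/6 - \<epsilon>)" and a: "coprime a (int q)"
    for X q a
  proof -
    have X2: "X \<ge> 2" using X exp_ge_add_one_self[of 1] by linarith
    have lnX: "ln X \<ge> 1" using X X2 by (simp add: ln_ge_iff)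
    define N where "N = nat \<lfloor>X\<rfloor>"
    define A where "A b = real (card (squarefree_class N q b))" for b
    define S where "S = real (card {n\<in>{1..N}. coprime n q \<and> squarefree n})"
    have q1: "q > 1" using q prime_gt_1_nat by blast
    have in_N: "0 < n \<and> real n \<le> X \<longleftrightarrow> n \<in> {1..N}" for n
      using X2 by (auto simp: N_def le_nat_floor le_nat_iff le_floor_iff)
    have "(\<Sum>n | 0 < n \<and> real n \<le> X \<and> P n. real_of_int ((moebius_mu n)\<^sup>2))
        = real (card {n\<in>{1..N}. P n \<and> squarefree n})" for P
    proof -
      have "{n. 0 < n \<and> real n \<le> X \<and> P n} = {n\<in>{1..N}. P n}" using in_N by auto
      hence "(\<Sum>n | 0 < n \<and> real n \<le> X \<and> P n. real_of_int ((moebius_mu n)\<^sup>2))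
          = (\<Sum>n\<in>{n\<in>{1..N}. P n}. if squarefree n then 1 else 0)"
        by (intro sum.cong) (auto simp: moebius_mu_squared)
      also have "\<dots> = (\<Sum>n\<in>{n\<in>{n\<in>{1..N}. P n}. squarefree n}. 1)"
        by (rule sum.inter_filter[symmetric]) simp
      finally show ?thesis by (simp add: conj_assoc)
    qed
    note sums = this[of "\<lambda>n. [int n = a] (mod int q)", folded squarefree_class_def A_def]
      this[of "\<lambda>n. coprime n q", folded S_def]
    \<comment> \<open>As \<open>ln X\<close> is at least 1, the range with \<open>\<epsilon>\<close>
      lies inside the one already treated.\<close>
    have "ln X powr (1/6 - \<epsilon>) \<le> ln X powr (1/6)"
      using lnX assms by (intro powr_mono) auto
    hence "X powr (2/3) * ln X powr (1/6 - \<epsilon>) \<le> X powr (2/3) * ln X powr (1/6)"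
      by (intro mult_left_mono) auto
    with q_le have q_le': "real q \<le> X powr (2/3) * ln X powr (1/6)" by linarith
    have diff: "\<bar>A a - A (int r)\<bar> \<le> \<eta> * (X / real q)" if r: "r \<in> {1..<q}" for r
    proof -
      have "coprime (int r) (int q)"
        using r q by (metis atLeastLessThan_iff coprime_commute coprime_int_iff less_le_trans
            nat_dvd_not_less prime_imp_coprime zero_less_one)
      thus ?thesis
        using close[OF _ q q_le', of "int r" a] close[OF _ q q_le' a, of "int r"] X
        by (auto simp: A_def N_def abs_le_iff)
    qed
    have "S = (\<Sum>r\<in>{1..<q}. A (int r))"
      unfolding S_def A_def card_squarefree_coprime_eq_sum[OF q] by simp
    \<comment> \<open>Multiplied by \<open>totient q = q - 1\<close>, the deviation from the average
      is a sum of \<open>q - 1\<close> differences, each at most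
      \<open>\<eta> * (X / q)\<close>.\<close>
    hence "real (q - 1) * A a - S = (\<Sum>r\<in>{1..<q}. A a - A (int r))"
      by (simp add: sum_subtractf)
    also have "\<bar>\<dots>\<bar> \<le> (\<Sum>r\<in>{1..<q}. \<bar>A a - A (int r)\<bar>)" by (rule sum_abs)
    also have "\<dots> \<le> (\<Sum>r\<in>{1..<q}. \<eta> * (X / real q))" by (intro sum_mono diff)
    also have "\<dots> = real (q - 1) * (\<eta> * (X / real q))" by simp
    also have "\<dots> \<le> real q * (\<eta> * (X / real q))"
      using \<eta> X2 by (intro mult_right_mono) auto
    also have "\<dots> = \<kappa> * (X / 16)" using q1 by (simp add: \<eta>_def)
    finally have dev: "\<bar>real (q - 1) * A a - S\<bar> \<le> \<kappa> * (X / 16)" .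
    have "X / 2 \<le> real N" using X2 unfolding N_def by linarith
    hence S: "X / 16 \<le> S" using card_squarefree_coprime_ge[OF q, of N] by (simp add: S_def)
    hence "\<kappa> * (X / 16) \<le> \<kappa> * S" using assms by (intro mult_left_mono) auto
    hence "\<bar>real (q - 1) * A a - S\<bar> \<le> \<kappa> * S" using dev by linarith
    hence "\<bar>(real (q - 1) * A a - S) / S\<bar> \<le> \<kappa>" using S X2 by (simp add: field_simps)
    moreover have "(real (q - 1) * A a - S) / S = A a / (1 / real (totient q) * S) - 1"
      using S X2 by (simp add: totient_prime[OF q] diff_divide_distrib)
    ultimately show ?thesis unfolding sums by (simp only:)
  qed
  thus ?thesis by blast
qed

end
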